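(* (a) Let $(A\oplus A^*;A,A^* )$ be a Manin triple of pre-Lie-Yamaguti algebras whose bilinear form is $\omega(x+\alpha,y+\beta)=\langle\alpha,y\rangle-\langle\beta,x\rangle$ ($x,y\in A$, $\alpha,\beta\in A^*$). Then $(A\oplus A^*,[\cdot,\cdot]_C,[\![\cdot,\cdot,\cdot]\!]_C;\omega)$, where $[\cdot,\cdot]_C,[\![\cdot,\cdot,\cdot]\!]_C$ are the brackets of the subadjacent Lie-Yamaguti algebra of the pre-Lie-Yamaguti algebra $A\oplus A^*$, is a symplectic Lie-Yamaguti algebra which is a phase space of the subadjacent Lie-Yamaguti algebra of $(A,*|_A,\{\cdot,\cdot,\cdot\}|_A)$. (b) Conversely, if $(\mathfrak h\oplus\mathfrak h^*,[\cdot,\cdot],[\![\cdot,\cdot,\cdot]\!];\omega_p)$ is a perfect phase space of a Lie-Yamaguti algebra $(\mathfrak h,[\cdot,\cdot]_{\mathfrak h},[\![\cdot,\cdot,\cdot]\!]_{\mathfrak h})$, then $(\mathfrak h\oplus\mathfrak h^*;\mathfrak h,\mathfrak h^* )$, with the pre-Lie-Yamaguti structure on $\mathfrak h\oplus\mathfrak h^*$ defined by $\omega_p(X*Y,Z)=-\omega_p(Y,[X,Z])$ and $\omega_p(\{X,Y,Z\},W)=\omega_p(X,[\![W,Z,Y]\!])$ and with form $\omega_p$, is a Manin triple of pre-Lie-Yamaguti algebras. Thus there is a one-to-one correspondence between Manin triples of pre-Lie-Yamaguti algebras and perfect phase spaces of Lie-Yamaguti algebras.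
   Context: All vector spaces are over a field of characteristic $0$ and finite-dimensional. A Lie-Yamaguti algebra is a vector space $\mathfrak g$ with a bilinear skew-symmetric $[\cdot,\cdot]$ and a trilinear $[\![\cdot,\cdot,\cdot]\!]$ skew-symmetric in its first two arguments such that for all $x,y,z,w,t$: (1) $[[x,y],z]+[[y,z],x]+[[z,x],y]+[\![x,y,z]\!]+[\![y,z,x]\!]+[\![z,x,y]\!]=0$; (2) $[\![[x,y],z,w]\!]+[\![[y,z],x,w]\!]+[\![[z,x],y,w]\!]=0$; (3) $[\![x,y,[z,w]]\!]=[[\![x,y,z]\!],w]+[z,[\![x,y,w]\!]]$; (4) $[\![x,y,[\![z,w,t]\!]]\!]=[\![[\![x,y,z]\!],w,t]\!]+[\![z,[\![x,y,w]\!],t]\!]+[\![z,w,[\![x,y,t]\!]]\!]$. A symplectic structure is a nondegenerate skew-symmetric bilinear form $\omega$ with $\omega(x,[y,z])+\omega(y,[z,x])+\omega(z,[x,y])=0$ and $\omega(z,[\![x,y,w]\!])-\omega(x,[\![w,z,y]\!])+\omega(y,[\![w,z,x]\!])-\omega(w,[\![x,y,z]\!])=0$. On $\mathfrak h\oplus\mathfrak h^*$, $\omega_p(x+\alpha,y+\beta)=\langle\alpha,y\rangle-\langle\beta,x\rangle$. A phase space of $\mathfrak h$ is a Lie-Yamaguti algebra structure on $\mathfrak h\oplus\mathfrak h^*$ for which $\omega_p$ is symplectic and $\mathfrak h$ (with its original brackets) and $\mathfrak h^*$ are Lie-Yamaguti subalgebras; it is perfect if for all $x,y\in\mathfrak h$,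 $\alpha,\beta\in\mathfrak h^*$: $[\![\alpha,\beta,x]\!]\in\mathfrak h$, $[\![x,\alpha,\beta]\!]\in\mathfrak h$, $[\![x,y,\alpha]\!]\in\mathfrak h^*$, $[\![\alpha,x,y]\!]\in\mathfrak h^*$. A pre-Lie-Yamaguti algebra is a vector space $A$ with a bilinear operation $*$ and a trilinear operation $\{\cdot,\cdot,\cdot\}$ such that, writing $[x,y]_C=x*y-y*x$, $(x,y,z)=(x*y)*z-x*(y*z)$ and $\{x,y,z\}_D=\{z,y,x\}-\{z,x,y\}+(y,x,z)-(x,y,z)$, for all $x,y,z,w,t\in A$: (P1) $\{z,[x,y]_C,w\}-\{y*z,x,w\}+\{x*z,y,w\}=0$; (P2) $\{x,y,[z,w]_C\}=z*\{x,y,w\}-w*\{x,y,z\}$; (P3) $\{\{x,y,z\},w,t\}-\{\{x,y,w\},z,t\}-\{x,y,\{z,w,t\}_D\}-\{x,y,\{z,w,t\}\}+\{x,y,\{w,z,t\}\}+\{z,w,\{x,y,t\}\}_D=0$; (P4) $\{z,\{x,y,w\}_D,t\}+\{z,\{x,y,w\},t\}-\{z,\{y,x,w\},t\}+\{z,w,\{x,y,t\}_D\}+\{z,w,\{x,y,t\}\}-\{z,w,\{y,x,t\}\}=\{x,y,\{z,w,t\}\}_D-\{\{x,y,z\}_D,w,t\}$; (P5) $\{x,y,z\}_D*w+\{x,y,z\}*w-\{y,x,z\}*w=\{x,y,z*w\}_D-z*\{x,y,w\}_D$. Its subadjacent Lie-Yamaguti algebra has brackets $[x,y]_C$ and $[\![x,y,z]\!]_C=\{x,y,z\}_D+\{x,y,z\}-\{y,x,z\}$.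 A quadratic pre-Lie-Yamaguti algebra is a pre-Lie-Yamaguti algebra with a nondegenerate skew-symmetric bilinear form $\omega$ such that $\omega(x*y,z)=-\omega(y,[x,z]_C)$ and $\omega(\{x,y,z\},w)=\omega(x,[\![w,z,y]\!]_C)$. A Manin triple of pre-Lie-Yamaguti algebras is a triple $(\mathscr A;A,A')$ where $(\mathscr A,*,\{\cdot,\cdot,\cdot\};\omega)$ is a quadratic pre-Lie-Yamaguti algebra, $\mathscr A=A\oplus A'$ as vector spaces with $A,A'$ subalgebras (closed under $*$ and $\{\cdot,\cdot,\cdot\}$), both $A$ and $A'$ isotropic for $\omega$, and for all $x,y\in A$, $\alpha,\beta\in A'$: $\{\alpha,\beta,x\},\{x,\alpha,\beta\},\{\alpha,x,\beta\}\in A$ and $\{x,y,\alpha\},\{\alpha,x,y\},\{x,\alpha,y\}\in A'$. Via $\langle\alpha,x\rangle:=\omega(\alpha,x)$, $A'$ is identified with $A^*$ and then $\omega$ takes the displayed form $\omega_p$. *)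

theory Defs
  imports "HOL-Analysis.Analysis"
begin

section \<open>Multilinearity (generic: additive group 'v with a scalar action of the field 'k)\<close>

definition bilinear_op :: "('k \<Rightarrow> 'v \<Rightarrow> 'v) \<Rightarrow> ('v::ab_group_add \<Rightarrow> 'v \<Rightarrow> 'v) \<Rightarrow> bool" where
  "bilinear_op sc f \<longleftrightarrow>
     (\<forall>x y z. f (x + y) z = f x z + f y z) \<and> (\<forall>x y z. f x (y + z) = f x y + f x z) \<and>
     (\<forall>c x y. f (sc c x) y = sc c (f x y)) \<and> (\<forall>c x y. f x (sc c y) = sc c (f x y))"

definition trilinear_op :: "('k \<Rightarrow> 'v \<Rightarrow> 'v) \<Rightarrow> ('v::ab_group_add \<Rightarrow> 'v \<Rightarrow> 'v \<Rightarrow> 'v) \<Rightarrow> bool" where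
  "trilinear_op sc f \<longleftrightarrow>
     (\<forall>x y z w. f (x + y) z w = f x z w + f y z w) \<and>
     (\<forall>x y z w. f x (y + z) w = f x y w + f x z w) \<and>
     (\<forall>x y z w. f x y (z + w) = f x y z + f x y w) \<and>
     (\<forall>c x y z. f (sc c x) y z = sc c (f x y z)) \<and>
     (\<forall>c x y z. f x (sc c y) z = sc c (f x y z)) \<and>
     (\<forall>c x y z. f x y (sc c z) = sc c (f x y z))"

definition bilinear_form :: "('k \<Rightarrow> 'v \<Rightarrow> 'v) \<Rightarrow> ('v::ab_group_add \<Rightarrow> 'v \<Rightarrow> 'k::field) \<Rightarrow> bool" where
  "bilinear_form sc om \<longleftrightarrow>
     (\<forall>x y z. om (x + y) z = om x z + om y z) \<and> (\<forall>x y z. om x (y + z) = om x y + om x z) \<and>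
     (\<forall>c x y. om (sc c x) y = c * om x y) \<and> (\<forall>c x y. om x (sc c y) = c * om x y)"

definition nondeg_skew_form :: "('k \<Rightarrow> 'v \<Rightarrow> 'v) \<Rightarrow> ('v::ab_group_add \<Rightarrow> 'v \<Rightarrow> 'k::field) \<Rightarrow> bool" where
  "nondeg_skew_form sc om \<longleftrightarrow> bilinear_form sc om \<and> (\<forall>x y. om x y = - om y x) \<and>
     (\<forall>x. (\<forall>y. om x y = 0) \<longrightarrow> x = 0)"

section \<open>Lie-Yamaguti algebras\<close>

definition LY :: "('k \<Rightarrow> 'v \<Rightarrow> 'v) \<Rightarrow> ('v::ab_group_add \<Rightarrow> 'v \<Rightarrow> 'v) \<Rightarrow> ('v \<Rightarrow> 'v \<Rightarrow> 'v \<Rightarrow> 'v) \<Rightarrow> bool" where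
  "LY sc br tr \<longleftrightarrow> bilinear_op sc br \<and> trilinear_op sc tr \<and>
     (\<forall>x y. br x y = - br y x) \<and> (\<forall>x y z. tr x y z = - tr y x z) \<and>
     (\<forall>x y z. br (br x y) z + br (br y z) x + br (br z x) y + tr x y z + tr y z x + tr z x y = 0) \<and>
     (\<forall>x y z w. tr (br x y) z w + tr (br y z) x w + tr (br z x) y w = 0) \<and>
     (\<forall>x y z w. tr x y (br z w) = br (tr x y z) w + br z (tr x y w)) \<and>
     (\<forall>x y z w t. tr x y (tr z w t) = tr (tr x y z) w t + tr z (tr x y w) t + tr z w (tr x y t))"

definition symplectic :: "('k \<Rightarrow> 'v \<Rightarrow> 'v) \<Rightarrow> ('v::ab_group_add \<Rightarrow> 'v \<Rightarrow> 'k::field) \<Rightarrow>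
    ('v \<Rightarrow> 'v \<Rightarrow> 'v) \<Rightarrow> ('v \<Rightarrow> 'v \<Rightarrow> 'v \<Rightarrow> 'v) \<Rightarrow> bool" where
  "symplectic sc om br tr \<longleftrightarrow> nondeg_skew_form sc om \<and>
     (\<forall>x y z. om x (br y z) + om y (br z x) + om z (br x y) = 0) \<and>
     (\<forall>x y z w. om z (tr x y w) - om x (tr w z y) + om y (tr w z x) - om w (tr x y z) = 0)"

section \<open>Pre-Lie-Yamaguti algebras\<close>

definition commC :: "('v::ab_group_add \<Rightarrow> 'v \<Rightarrow> 'v) \<Rightarrow> 'v \<Rightarrow> 'v \<Rightarrow> 'v" where
  "commC mul x y = mul x y - mul y x"

definition assoc3 :: "('v::ab_group_add \<Rightarrow> 'v \<Rightarrow> 'v) \<Rightarrow> 'v \<Rightarrow> 'v \<Rightarrow> 'v \<Rightarrow> 'v" where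
  "assoc3 mul x y z = mul (mul x y) z - mul x (mul y z)"

definition triD :: "('v::ab_group_add \<Rightarrow> 'v \<Rightarrow> 'v) \<Rightarrow> ('v \<Rightarrow> 'v \<Rightarrow> 'v \<Rightarrow> 'v) \<Rightarrow> 'v \<Rightarrow> 'v \<Rightarrow> 'v \<Rightarrow> 'v" where
  "triD mul tri x y z = tri z y x - tri z x y + assoc3 mul y x z - assoc3 mul x y z"

text \<open>Ternary bracket of the subadjacent Lie-Yamaguti algebra.\<close>
definition triC :: "('v::ab_group_add \<Rightarrow> 'v \<Rightarrow> 'v) \<Rightarrow> ('v \<Rightarrow> 'v \<Rightarrow> 'v \<Rightarrow> 'v) \<Rightarrow> 'v \<Rightarrow> 'v \<Rightarrow> 'v \<Rightarrow> 'v" where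
  "triC mul tri x y z = triD mul tri x y z + tri x y z - tri y x z"

definition preLY :: "('k \<Rightarrow> 'v \<Rightarrow> 'v) \<Rightarrow> ('v::ab_group_add \<Rightarrow> 'v \<Rightarrow> 'v) \<Rightarrow> ('v \<Rightarrow> 'v \<Rightarrow> 'v \<Rightarrow> 'v) \<Rightarrow> bool" where
  "preLY sc mul tri \<longleftrightarrow> bilinear_op sc mul \<and> trilinear_op sc tri \<and>
   (\<forall>x y z w. tri z (commC mul x y) w - tri (mul y z) x w + tri (mul x z) y w = 0) \<and>
   (\<forall>x y z w. tri x y (commC mul z w) = mul z (tri x y w) - mul w (tri x y z)) \<and>
   (\<forall>x y z w t. tri (tri x y z) w t - tri (tri x y w) z t - tri x y (triD mul tri z w t)
        - tri x y (tri z w t) + tri x y (tri w z t) + triD mul tri z w (tri x y t) = 0) \<and>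
   (\<forall>x y z w t. tri z (triD mul tri x y w) t + tri z (tri x y w) t - tri z (tri y x w) t
        + tri z w (triD mul tri x y t) + tri z w (tri x y t) - tri z w (tri y x t)
        = triD mul tri x y (tri z w t) - tri (triD mul tri x y z) w t) \<and>
   (\<forall>x y z w. mul (triD mul tri x y z) w + mul (tri x y z) w - mul (tri y x z) w
        = triD mul tri x y (mul z w) - mul z (triD mul tri x y w))"

definition quadratic_preLY :: "('k \<Rightarrow> 'v \<Rightarrow> 'v) \<Rightarrow> ('v::ab_group_add \<Rightarrow> 'v \<Rightarrow> 'v) \<Rightarrow>
    ('v \<Rightarrow> 'v \<Rightarrow> 'v \<Rightarrow> 'v) \<Rightarrow> ('v \<Rightarrow> 'v \<Rightarrow> 'k::field) \<Rightarrow> bool" where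
  "quadratic_preLY sc mul tri om \<longleftrightarrow> preLY sc mul tri \<and> nondeg_skew_form sc om \<and>
     (\<forall>x y z. om (mul x y) z = - om y (commC mul x z)) \<and>
     (\<forall>x y z w. om (tri x y z) w = om x (triC mul tri w z y))"

section \<open>The double \<open>A \<oplus> A*\<close>\<close>

text \<open>A finite-dimensional space A over the field 'k is modelled as \<open>'k^'n\<close> ('n finite);
  its dual A* is modelled as \<open>'k^'n\<close> as well, with pairing \<open>\<langle>\<alpha>,x\<rangle> = \<Sum>i. \<alpha>$i * x$i\<close>.
  An element \<open>x + \<alpha>\<close> of \<open>A \<oplus> A*\<close> is the pair \<open>(x, \<alpha>)\<close>.\<close>

type_synonym ('k, 'n) dbl = "('k ^ 'n) \<times> ('k ^ 'n)"

definition dpair :: "'k::field ^ 'n::finite \<Rightarrow> 'k ^ 'n \<Rightarrow> 'k" where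
  "dpair \<alpha> x = (\<Sum>i\<in>UNIV. \<alpha> $ i * x $ i)"

definition dsc :: "'k::field \<Rightarrow> ('k, 'n::finite) dbl \<Rightarrow> ('k, 'n) dbl" where
  "dsc c X = (c *s fst X, c *s snd X)"

definition omega_p :: "('k::field, 'n::finite) dbl \<Rightarrow> ('k, 'n) dbl \<Rightarrow> 'k" where
  "omega_p X Y = dpair (snd X) (fst Y) - dpair (snd Y) (fst X)"

text \<open>Embeddings of \<open>A\<close> (as \<open>x + 0\<close>) and \<open>A*\<close> (as \<open>0 + \<alpha>\<close>).\<close>
definition inA :: "'k::field ^ 'n::finite \<Rightarrow> ('k, 'n) dbl" where "inA x = (x, 0)"
definition inD :: "'k::field ^ 'n::finite \<Rightarrow> ('k, 'n) dbl" where "inD \<alpha> = (0, \<alpha>)"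

definition isA :: "('k::field, 'n::finite) dbl \<Rightarrow> bool" where "isA X \<longleftrightarrow> snd X = 0"
definition isD :: "('k::field, 'n::finite) dbl \<Rightarrow> bool" where "isD X \<longleftrightarrow> fst X = 0"

text \<open>Manin triple \<open>(A \<oplus> A*; A, A*)\<close> of pre-Lie-Yamaguti algebras with form \<open>\<omega>_p\<close>.\<close>
definition manin_triple :: "(('k::field, 'n::finite) dbl \<Rightarrow> ('k, 'n) dbl \<Rightarrow> ('k, 'n) dbl) \<Rightarrow>
    (('k, 'n) dbl \<Rightarrow> ('k, 'n) dbl \<Rightarrow> ('k, 'n) dbl \<Rightarrow> ('k, 'n) dbl) \<Rightarrow> bool" where
  "manin_triple mul tri \<longleftrightarrow> quadratic_preLY dsc mul tri omega_p \<and>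
     (\<forall>x y. isA (mul (inA x) (inA y))) \<and> (\<forall>x y z. isA (tri (inA x) (inA y) (inA z))) \<and>
     (\<forall>a b. isD (mul (inD a) (inD b))) \<and> (\<forall>a b c. isD (tri (inD a) (inD b) (inD c))) \<and>
     (\<forall>x y :: 'k ^ 'n. omega_p (inA x) (inA y) = 0) \<and> (\<forall>a b :: 'k ^ 'n. omega_p (inD a) (inD b) = 0) \<and>
     (\<forall>x a b. isA (tri (inD a) (inD b) (inA x)) \<and> isA (tri (inA x) (inD a) (inD b))
              \<and> isA (tri (inD a) (inA x) (inD b))) \<and>
     (\<forall>x y a. isD (tri (inA x) (inA y) (inD a)) \<and> isD (tri (inD a) (inA x) (inA y))
              \<and> isD (tri (inA x) (inD a) (inA y)))"

text \<open>Restrictions of operations on \<open>A \<oplus> A*\<close> to the subspace \<open>A\<close>.\<close>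
definition restrA2 :: "(('k::field, 'n::finite) dbl \<Rightarrow> ('k, 'n) dbl \<Rightarrow> ('k, 'n) dbl) \<Rightarrow> 'k ^ 'n \<Rightarrow> 'k ^ 'n \<Rightarrow> 'k ^ 'n" where
  "restrA2 f x y = fst (f (inA x) (inA y))"
definition restrA3 :: "(('k::field, 'n::finite) dbl \<Rightarrow> ('k, 'n) dbl \<Rightarrow> ('k, 'n) dbl \<Rightarrow> ('k, 'n) dbl) \<Rightarrow>
    'k ^ 'n \<Rightarrow> 'k ^ 'n \<Rightarrow> 'k ^ 'n \<Rightarrow> 'k ^ 'n" where
  "restrA3 f x y z = fst (f (inA x) (inA y) (inA z))"

text \<open>Phase space of the Lie-Yamaguti algebra \<open>(\<h>, brh, trh)\<close>, \<open>\<h> = 'k^'n\<close>: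
  a Lie-Yamaguti structure \<open>(br, tr)\<close> on \<open>\<h> \<oplus> \<h>*\<close> with \<open>\<omega>_p\<close> symplectic, \<open>\<h>\<close> (with its
  original brackets) and \<open>\<h>*\<close> subalgebras.\<close>
definition phase_space :: "('k::field ^ 'n::finite \<Rightarrow> 'k ^ 'n \<Rightarrow> 'k ^ 'n) \<Rightarrow> ('k ^ 'n \<Rightarrow> 'k ^ 'n \<Rightarrow> 'k ^ 'n \<Rightarrow> 'k ^ 'n) \<Rightarrow>
    (('k, 'n) dbl \<Rightarrow> ('k, 'n) dbl \<Rightarrow> ('k, 'n) dbl) \<Rightarrow>
    (('k, 'n) dbl \<Rightarrow> ('k, 'n) dbl \<Rightarrow> ('k, 'n) dbl \<Rightarrow> ('k, 'n) dbl) \<Rightarrow> bool" where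
  "phase_space brh trh br tr \<longleftrightarrow> LY (*s) brh trh \<and> LY dsc br tr \<and> symplectic dsc omega_p br tr \<and>
     (\<forall>x y. br (inA x) (inA y) = inA (brh x y)) \<and>
     (\<forall>x y z. tr (inA x) (inA y) (inA z) = inA (trh x y z)) \<and>
     (\<forall>a b. isD (br (inD a) (inD b))) \<and> (\<forall>a b c. isD (tr (inD a) (inD b) (inD c)))"

definition perfect :: "(('k::field, 'n::finite) dbl \<Rightarrow> ('k, 'n) dbl \<Rightarrow> ('k, 'n) dbl \<Rightarrow> ('k, 'n) dbl) \<Rightarrow> bool" where
  "perfect tr \<longleftrightarrow> (\<forall>x y a b.
     isA (tr (inD a) (inD b) (inA x)) \<and> isA (tr (inA x) (inD a) (inD b)) \<and>
     isD (tr (inA x) (inA y) (inD a)) \<and> isD (tr (inD a) (inA x) (inA y)))"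

text \<open>The pre-Lie-Yamaguti structure induced on \<open>\<h> \<oplus> \<h>*\<close> by
  \<open>\<omega>_p(X*Y,Z) = -\<omega>_p(Y,[X,Z])\<close> and \<open>\<omega>_p({X,Y,Z},W) = \<omega>_p(X,[[W,Z,Y]])\<close>.\<close>
definition ind_mul :: "(('k::field, 'n::finite) dbl \<Rightarrow> ('k, 'n) dbl \<Rightarrow> ('k, 'n) dbl) \<Rightarrow>
    ('k, 'n) dbl \<Rightarrow> ('k, 'n) dbl \<Rightarrow> ('k, 'n) dbl" where
  "ind_mul br X Y = (THE P. \<forall>Z. omega_p P Z = - omega_p Y (br X Z))"

definition ind_tri :: "(('k::field, 'n::finite) dbl \<Rightarrow> ('k, 'n) dbl \<Rightarrow> ('k, 'n) dbl \<Rightarrow> ('k, 'n) dbl) \<Rightarrow>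
    ('k, 'n) dbl \<Rightarrow> ('k, 'n) dbl \<Rightarrow> ('k, 'n) dbl \<Rightarrow> ('k, 'n) dbl" where
  "ind_tri tr X Y Z = (THE P. \<forall>W. omega_p P W = omega_p X (tr W Z Y))"

end

theory Submission
  imports Defs
begin

(*
  The two constructions are adjoint to each other through the symplectic form.  Writing
  om(x*y, z) = -om(y, [x,z]) and om({x,y,z}, w) = om(x, [[w,z,y]]), each pre-Lie-Yamaguti identity,
  paired with one more vector, becomes one of the Lie-Yamaguti identities (2)-(4).  By
  nondegeneracy the pre-Lie-Yamaguti axioms for * and {,,} are therefore equivalent to the
  Lie-Yamaguti axioms for [,] and [[,,]], as soon as [,] is the commutator of * and [[,,]] is the
  subadjacent ternary bracket.  These two provisos are exactly the two symplectic conditions: the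
  cyclic condition on om is equivalent to [x,y] = x*y - y*x (in characteristic other than 3), and,
  given identity (1), the second condition is equivalent to [[,,]] being the subadjacent bracket.

  On A + A* the form om_p is nondegenerate, so every bilinear or trilinear bracket has unique
  adjoints, and under the same adjunction the isotropy and mixed-closure conditions of a Manin
  triple become the subalgebra and perfectness conditions of a phase space.
*)

section \<open>Multilinear operations and subadjacent brackets\<close>

lemma bilinear_op_laws:
  assumes "bilinear_op sc f"
  shows "f (x + y) z = f x z + f y z" "f 0 z = 0" "f (- x) z = - f x z" "f (x - y) z = f x z - f y z"
    and "f x (y + z) = f x y + f x z" "f x 0 = 0" "f x (- y) = - f x y" "f x (y - z) = f x y - f x z"
    and "f (sc c x) z = sc c (f x z)" "f x (sc c y) = sc c (f x y)"
proof -
  interpret left: Modules.additive "\<lambda>x. f x z"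
    using assms by unfold_locales (simp add: bilinear_op_def)
  interpret right: Modules.additive "f x"
    using assms by unfold_locales (simp add: bilinear_op_def)
  show "f (x + y) z = f x z + f y z" "f 0 z = 0" "f (- x) z = - f x z" "f (x - y) z = f x z - f y z"
    using left.add left.zero left.minus left.diff by simp_all
  show "f x (y + z) = f x y + f x z" "f x 0 = 0" "f x (- y) = - f x y" "f x (y - z) = f x y - f x z"
    using right.add right.zero right.minus right.diff by simp_all
  show "f (sc c x) z = sc c (f x z)" "f x (sc c y) = sc c (f x y)"
    using assms by (simp_all add: bilinear_op_def)
qed

lemma trilinear_op_laws:
  assumes "trilinear_op sc f"
  shows "f (x + x') y z = f x y z + f x' y z" "f 0 y z = 0" "f (- x) y z = - f x y z"
      "f (x - x') y z = f x y z - f x' y z"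
    and "f x (y + y') z = f x y z + f x y' z" "f x 0 z = 0" "f x (- y) z = - f x y z"
      "f x (y - y') z = f x y z - f x y' z"
    and "f x y (z + z') = f x y z + f x y z'" "f x y 0 = 0" "f x y (- z) = - f x y z"
      "f x y (z - z') = f x y z - f x y z'"
    and "f (sc c x) y z = sc c (f x y z)" "f x (sc c y) z = sc c (f x y z)"
      "f x y (sc c z) = sc c (f x y z)"
proof -
  interpret first: Modules.additive "\<lambda>x. f x y z"
    using assms by unfold_locales (simp add: trilinear_op_def)
  interpret second: Modules.additive "\<lambda>y. f x y z"
    using assms by unfold_locales (simp add: trilinear_op_def)
  interpret third: Modules.additive "f x y"
    using assms by unfold_locales (simp add: trilinear_op_def)
  show "f (x + x') y z = f x y z + f x' y z" "f 0 y z = 0" "f (- x) y z = - f x y z"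
      "f (x - x') y z = f x y z - f x' y z"
    using first.add first.zero first.minus first.diff by simp_all
  show "f x (y + y') z = f x y z + f x y' z" "f x 0 z = 0" "f x (- y) z = - f x y z"
      "f x (y - y') z = f x y z - f x y' z"
    using second.add second.zero second.minus second.diff by simp_all
  show "f x y (z + z') = f x y z + f x y z'" "f x y 0 = 0" "f x y (- z) = - f x y z"
      "f x y (z - z') = f x y z - f x y z'"
    using third.add third.zero third.minus third.diff by simp_all
  show "f (sc c x) y z = sc c (f x y z)" "f x (sc c y) z = sc c (f x y z)"
      "f x y (sc c z) = sc c (f x y z)"
    using assms by (simp_all add: trilinear_op_def)
qed

lemma bilinear_form_laws:
  assumes "bilinear_form sc om"
  shows "om (x + y) z = om x z + om y z" "om 0 z = 0" "om (- x) z = - om x z"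
      "om (x - y) z = om x z - om y z"
    and "om x (y + z) = om x y + om x z" "om x 0 = 0" "om x (- y) = - om x y"
      "om x (y - z) = om x y - om x z"
    and "om (sc c x) z = c * om x z" "om x (sc c y) = c * om x y"
proof -
  interpret left: Modules.additive "\<lambda>x. om x z"
    using assms by unfold_locales (simp add: bilinear_form_def)
  interpret right: Modules.additive "om x"
    using assms by unfold_locales (simp add: bilinear_form_def)
  show "om (x + y) z = om x z + om y z" "om 0 z = 0" "om (- x) z = - om x z"
      "om (x - y) z = om x z - om y z"
    using left.add left.zero left.minus left.diff by simp_all
  show "om x (y + z) = om x y + om x z" "om x 0 = 0" "om x (- y) = - om x y"
      "om x (y - z) = om x y - om x z"
    using right.add right.zero right.minus right.diff by simp_all
  show "om (sc c x) z = c * om x z" "om x (sc c y) = c * om x y"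
    using assms by (simp_all add: bilinear_form_def)
qed

lemma triC_skew: "triC mul tri x y z = - triC mul tri y x z"
  by (simp add: triC_def triD_def algebra_simps)

lemma subadjacent_jacobi:
  assumes "bilinear_op sc mul"
  shows "commC mul (commC mul x y) z + commC mul (commC mul y z) x + commC mul (commC mul z x) y
    + triC mul tri x y z + triC mul tri y z x + triC mul tri z x y = 0"
  by (simp add: commC_def triC_def triD_def assoc3_def bilinear_op_laws(4,8)[OF assms])

lemma commC_hom:
  assumes "Modules.additive f" and "\<And>x y. f (m x y) = M (f x) (f y)"
  shows "f (commC m x y) = commC M (f x) (f y)"
  using assms by (simp add: commC_def Modules.additive.diff)

lemma triC_hom:
  assumes "Modules.additive f" and "\<And>x y. f (m x y) = M (f x) (f y)"
    and "\<And>x y z. f (t x y z) = T (f x) (f y) (f z)"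
  shows "f (triC m t x y z) = triC M T (f x) (f y) (f z)"
  using assms by (simp add: triC_def triD_def assoc3_def Modules.additive.add Modules.additive.diff)

lemma LY_pullback:
  assumes LY: "LY sc' M T" and inj: "inj f" and add: "Modules.additive f"
    and scale: "\<And>c x. f (sc c x) = sc' c (f x)"
    and mul: "\<And>x y. f (m x y) = M (f x) (f y)" and tri: "\<And>x y z. f (t x y z) = T (f x) (f y) (f z)"
  shows "LY sc m t"
proof -
  interpret f: Modules.additive f
    by (fact add)
  from LY[unfolded LY_def]
  have M: "bilinear_op sc' M" and T: "trilinear_op sc' T"
    and skew: "\<And>x y. M x y = - M y x" "\<And>x y z. T x y z = - T y x z"
    and identities:
      "\<And>x y z. M (M x y) z + M (M y z) x + M (M z x) y + T x y z + T y z x + T z x y = 0"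
      "\<And>x y z w. T (M x y) z w + T (M y z) x w + T (M z x) y w = 0"
      "\<And>x y z w. T x y (M z w) = M (T x y z) w + M z (T x y w)"
      "\<And>x y z w u. T x y (T z w u) = T (T x y z) w u + T z (T x y w) u + T z w (T x y u)"
    by iprover+
  note hom = f.add f.diff f.minus f.zero scale mul tri bilinear_op_laws[OF M] trilinear_op_laws[OF T]
  show ?thesis
    unfolding LY_def bilinear_op_def trilinear_op_def
    by (intro conjI allI; rule injD[OF inj]; simp only: hom; (rule skew identities)?)
qed

section \<open>Adjoints with respect to a nondegenerate skew form\<close>

locale skew_form =
  fixes sc :: "'k::field \<Rightarrow> 'v::ab_group_add \<Rightarrow> 'v" and om :: "'v \<Rightarrow> 'v \<Rightarrow> 'k"
  assumes nondeg_skew: "nondeg_skew_form sc om"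
begin

lemmas om_laws = bilinear_form_laws[OF nondeg_skew[unfolded nondeg_skew_form_def, THEN conjunct1]]

lemma om_skew: "om x y = - om y x"
  using nondeg_skew unfolding nondeg_skew_form_def by blast

lemma om_nondeg: "(\<And>z. om x z = 0) \<Longrightarrow> x = 0"
  using nondeg_skew unfolding nondeg_skew_form_def by blast

lemma om_zero [simp]: "om 0 z = 0" "om x 0 = 0"
  by (simp_all add: om_laws)

lemma om_eqI: "(\<And>z. om x z = om y z) \<Longrightarrow> x = y"
  using om_nondeg[of "x - y"] by (simp add: om_laws)

lemma om_eqI_right: "(\<And>z. om z x = om z y) \<Longrightarrow> x = y"
  by (rule om_eqI) (metis om_skew)

lemma om_nondeg_right: "(\<And>z. om z x = 0) \<Longrightarrow> x = 0"
  using om_nondeg om_skew by (metis neg_equal_0_iff_equal)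

lemma om_diff_eqI: "(\<And>z. om (x - y) z = 0) \<Longrightarrow> x = y"
  using om_nondeg[of "x - y"] by simp

lemma om_diff_eqI_right: "(\<And>z. om z (x - y) = 0) \<Longrightarrow> x = y"
  using om_nondeg_right[of "x - y"] by simp

lemma the_om_eq:
  assumes "\<exists>p. \<forall>z. om p z = f z"
  shows "(THE p. \<forall>z. om p z = f z) = q \<longleftrightarrow> (\<forall>z. om q z = f z)"
proof -
  obtain p where p: "\<forall>z. om p z = f z"
    using assms by blast
  then have "(THE p. \<forall>z. om p z = f z) = p"
    by (intro the_equality) (auto intro: om_eqI)
  with p show ?thesis
    by (auto intro: om_eqI)
qed

lemma bilinear_op_iff_adjoint:
  assumes adj: "\<And>x y z. om (mul x y) z = - om y (br x z)"
  shows "bilinear_op sc mul \<longleftrightarrow> bilinear_op sc br"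
proof
  have adj': "om y (br x z) = - om (mul x y) z" for x y z
    by (simp add: adj)
  assume "bilinear_op sc mul"
  note laws = bilinear_op_laws[OF this]
  show "bilinear_op sc br"
    unfolding bilinear_op_def
    by (intro conjI allI; rule om_eqI_right; simp add: adj' laws om_laws)
next
  assume "bilinear_op sc br"
  note laws = bilinear_op_laws[OF this]
  show "bilinear_op sc mul"
    unfolding bilinear_op_def
    by (intro conjI allI; rule om_eqI; simp add: adj laws om_laws)
qed

lemma trilinear_op_iff_adjoint:
  assumes adj: "\<And>x y z w. om (tri x y z) w = om x (trt w z y)"
  shows "trilinear_op sc tri \<longleftrightarrow> trilinear_op sc trt"
proof
  have adj': "om x (trt w z y) = om (tri x y z) w" for x y z w
    by (simp add: adj)
  assume "trilinear_op sc tri"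
  note laws = trilinear_op_laws[OF this]
  show "trilinear_op sc trt"
    unfolding trilinear_op_def
    by (intro conjI allI; rule om_eqI_right; simp add: adj' laws om_laws)
next
  assume "trilinear_op sc trt"
  note laws = trilinear_op_laws[OF this]
  show "trilinear_op sc tri"
    unfolding trilinear_op_def
    by (intro conjI allI; rule om_eqI; simp add: adj laws om_laws)
qed

lemma commC_eq_of_cyclic:
  assumes adj: "\<And>x y z. om (mul x y) z = - om y (br x z)"
    and br_skew: "\<And>x y. br x y = - br y x"
    and cyclic: "\<And>x y z. om x (br y z) + om y (br z x) + om z (br x y) = 0"
  shows "commC mul = br"
proof (intro ext om_eqI)
  fix x y z
  have "om (commC mul x y) z = om x (br y z) - om y (br x z)"
    by (simp add: commC_def om_laws adj)
  also have "\<dots> = om (br x y) z"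
    using cyclic[of x y z] br_skew[of z x] om_skew[of z "br x y"] by (simp add: om_laws)
  finally show "om (commC mul x y) z = om (br x y) z" .
qed

lemma cyclic_of_commC_eq:
  assumes adj: "\<And>x y z. om (mul x y) z = - om y (br x z)"
    and commC_eq: "commC mul = br" and three: "(3::'k) \<noteq> 0"
  shows "om x (br y z) + om y (br z x) + om z (br x y) = 0"
proof -
  have swap: "om a (br b c) = om c (mul b a)" for a b c
    using adj[of b a c] om_skew[of c "mul b a"] by simp
  have br_skew: "br a b = - br b a" for a b
    unfolding commC_eq[symmetric] commC_def by simp
  let ?cyc = "om x (br y z) + om y (br z x) + om z (br x y)"
  have "?cyc = om z (mul y x) + om x (mul z y) + om y (mul x z)"
    by (simp only: swap)
  moreover have "?cyc = - (om y (mul z x) + om z (mul x y) + om x (mul y z))"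
    by (subst (1 2 3) br_skew) (simp add: om_laws swap)
  moreover have "?cyc = (om x (mul y z) - om x (mul z y)) + (om y (mul z x) - om y (mul x z))
      + (om z (mul x y) - om z (mul y x))"
    by (simp add: commC_eq[symmetric] commC_def om_laws)
  ultimately have "3 * ?cyc = 0"
    by algebra
  with three show ?thesis
    by (metis mult_eq_0_iff)
qed

end

section \<open>Pre-Lie-Yamaguti identities as adjoints of Lie-Yamaguti identities\<close>

(* trt is not required to be the subadjacent ternary bracket of (mul, tri): for a phase space this
   is what the second symplectic condition provides, see triC_eq_iff_symplectic. *)
locale adjoint_brackets = skew_form sc om
  for sc :: "'k::field \<Rightarrow> 'v::ab_group_add \<Rightarrow> 'v" and om +
  fixes mul :: "'v \<Rightarrow> 'v \<Rightarrow> 'v" and tri :: "'v \<Rightarrow> 'v \<Rightarrow> 'v \<Rightarrow> 'v"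
    and br :: "'v \<Rightarrow> 'v \<Rightarrow> 'v" and trt :: "'v \<Rightarrow> 'v \<Rightarrow> 'v \<Rightarrow> 'v"
  assumes mul_bilinear: "bilinear_op sc mul" and tri_trilinear: "trilinear_op sc tri"
    and commC_eq: "commC mul = br" and trt_skew: "trt x y z = - trt y x z"
    and mul_adjoint: "om (mul x y) z = - om y (br x z)"
    and tri_adjoint: "om (tri x y z) w = om x (trt w z y)"
    and jacobi: "br (br x y) z + br (br y z) x + br (br z x) y + trt x y z + trt y z x + trt z x y = 0"
begin

lemma br_bilinear: "bilinear_op sc br"
  using mul_bilinear bilinear_op_iff_adjoint[of mul br, OF mul_adjoint] by blast

lemma trt_trilinear: "trilinear_op sc trt"
  using tri_trilinear trilinear_op_iff_adjoint[of tri trt, OF tri_adjoint] by blast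

lemmas mul_laws = bilinear_op_laws[OF mul_bilinear]
lemmas tri_laws = trilinear_op_laws[OF tri_trilinear]
lemmas br_laws = bilinear_op_laws[OF br_bilinear]
lemmas trt_laws = trilinear_op_laws[OF trt_trilinear]

lemma br_eq: "br x y = mul x y - mul y x"
  unfolding commC_eq[symmetric] commC_def ..

lemma br_skew: "br x y = - br y x"
  unfolding br_eq by simp

lemma triD_adjoint: "om (triD mul tri x y z) w = - om z (trt x y w)"
proof -
  have "om (triD mul tri x y z) w
      = om z (br (br x y) w + br (br y w) x + br (br w x) y + trt y w x + trt w x y)"
    using trt_skew[of y w x]
    by (simp add: triD_def assoc3_def om_laws mul_laws tri_adjoint mul_adjoint br_eq algebra_simps)
  also have "\<dots> = om z (- trt x y w)"
    using jacobi[of x y w] by (intro arg_cong[where f = "om z"]) (simp add: eq_neg_iff_add_eq_0 ac_simps)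
  finally show ?thesis
    by (simp add: om_laws)
qed

lemma triC_pairing:
  "om (triC mul tri x y z - trt x y z) w
     = - (om z (trt x y w) - om x (trt w z y) + om y (trt w z x) - om w (trt x y z))"
  using om_skew[of "trt x y z" w] by (simp add: triC_def om_laws triD_adjoint tri_adjoint)

lemma triC_eq_iff_symplectic:
  "triC mul tri = trt \<longleftrightarrow>
     (\<forall>x y z w. om z (trt x y w) - om x (trt w z y) + om y (trt w z x) - om w (trt x y z) = 0)"
    (is "_ \<longleftrightarrow> (\<forall>x y z w. ?ST x y z w = 0)")
proof
  assume eq: "triC mul tri = trt"
  show "\<forall>x y z w. ?ST x y z w = 0"
  proof (intro allI)
    fix x y z w
    from triC_pairing[of x y z w] show "?ST x y z w = 0"
      by (simp add: eq om_laws)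
  qed
next
  assume ST: "\<forall>x y z w. ?ST x y z w = 0"
  have "triC mul tri x y z - trt x y z = 0" for x y z
  proof (rule om_nondeg)
    fix w
    show "om (triC mul tri x y z - trt x y z) w = 0"
      unfolding triC_pairing using ST by simp
  qed
  then show "triC mul tri = trt"
    by (simp add: fun_eq_iff)
qed

end

locale subadjacent_brackets = adjoint_brackets +
  assumes triC_eq: "triC mul tri = trt"
begin

lemma triC_apply: "triC mul tri x y z = trt x y z"
  by (simp add: triC_eq)

(* Paired with a further vector, the pre-Lie-Yamaguti identities (P1) and (P5) become the
   Lie-Yamaguti identity (3) of br, trt, (P2) becomes (2), and (P3) and (P4) become (4). *)
lemma preLY1_pairing:
  "om (tri z (commC mul x y) w - tri (mul y z) x w + tri (mul x z) y w) t
     = om z (trt t w (br x y) - (br (trt t w x) y + br x (trt t w y)))"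
  using br_skew[of y "trt t w x"]
  by (simp add: om_laws tri_laws commC_eq mul_adjoint tri_adjoint br_laws trt_laws)

lemma preLY2_pairing:
  "om (tri x y (commC mul z w) - (mul z (tri x y w) - mul w (tri x y z))) t
     = - om x (trt (br t z) w y + trt (br z w) t y + trt (br w t) z y)"
  using trt_skew[of t "br z w" y] br_skew[of z t]
  by (simp add: om_laws commC_eq mul_adjoint tri_adjoint br_laws trt_laws)

lemma preLY3_pairing:
  "om (tri (tri x y z) w t - tri (tri x y w) z t - tri x y (triD mul tri z w t)
        - tri x y (tri z w t) + tri x y (tri w z t) + triD mul tri z w (tri x y t)) s
   = om x ((trt z w (trt s t y) - (trt (trt z w s) t y + trt s (trt z w t) y + trt s t (trt z w y)))
         + (trt s t (trt z w y) - (trt (trt s t z) w y + trt z (trt s t w) y + trt z w (trt s t y))))"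
proof -
  have "om x (trt s (triD mul tri z w t) y) + om x (trt s (tri z w t) y) - om x (trt s (tri w z t) y)
      = om x (trt s (trt z w t) y)"
    by (simp only: triC_apply[of z w t, symmetric]) (simp add: triC_def trt_laws om_laws)
  then show ?thesis
    by (simp add: trt_skew[of "trt s t w" z y] om_laws triD_adjoint mul_adjoint tri_adjoint
        trt_laws tri_laws algebra_simps)
qed

lemma preLY4_pairing:
  "om ((tri z (triD mul tri x y w) t + tri z (tri x y w) t - tri z (tri y x w) t
        + tri z w (triD mul tri x y t) + tri z w (tri x y t) - tri z w (tri y x t))
        - (triD mul tri x y (tri z w t) - tri (triD mul tri x y z) w t)) s
   = - om z (trt x y (trt s t w) - (trt (trt x y s) t w + trt s (trt x y t) w + trt s t (trt x y w)))"
proof -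
  have "om z (trt s t (triD mul tri x y w)) + om z (trt s t (tri x y w)) - om z (trt s t (tri y x w))
      = om z (trt s t (trt x y w))"
    by (simp only: triC_apply[of x y w, symmetric]) (simp add: triC_def trt_laws om_laws)
  moreover have "om z (trt s (triD mul tri x y t) w) + om z (trt s (tri x y t) w) - om z (trt s (tri y x t) w)
      = om z (trt s (trt x y t) w)"
    by (simp only: triC_apply[of x y t, symmetric]) (simp add: triC_def trt_laws om_laws)
  ultimately show ?thesis
    by (simp add: om_laws triD_adjoint mul_adjoint tri_adjoint trt_laws tri_laws add_diff_eq)
qed

lemma preLY5_pairing:
  "om ((mul (triD mul tri x y z) w + mul (tri x y z) w - mul (tri y x z) w)
        - (triD mul tri x y (mul z w) - mul z (triD mul tri x y w))) t
   = om w (trt x y (br z t) - (br (trt x y z) t + br z (trt x y t)))"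
proof -
  have "mul (triD mul tri x y z) w + mul (tri x y z) w - mul (tri y x z) w = mul (trt x y z) w"
    by (simp only: triC_apply[of x y z, symmetric]) (simp add: triC_def mul_laws)
  then show ?thesis
    by (simp add: om_laws triD_adjoint mul_adjoint tri_adjoint trt_laws tri_laws br_laws)
qed

lemma LY_of_preLY:
  assumes "preLY sc mul tri"
  shows "LY sc br trt"
proof -
  from assms have P1: "\<And>x y z w. tri z (commC mul x y) w - tri (mul y z) x w + tri (mul x z) y w = 0"
    unfolding preLY_def by iprover
  from assms have P2: "\<And>x y z w. tri x y (commC mul z w) = mul z (tri x y w) - mul w (tri x y z)"
    unfolding preLY_def by iprover
  from assms have P4: "\<And>x y z w t. tri z (triD mul tri x y w) t + tri z (tri x y w) t - tri z (tri y x w) t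
        + tri z w (triD mul tri x y t) + tri z w (tri x y t) - tri z w (tri y x t)
        = triD mul tri x y (tri z w t) - tri (triD mul tri x y z) w t"
    unfolding preLY_def by iprover
  show ?thesis
    unfolding LY_def
  proof (intro conjI allI br_bilinear trt_trilinear br_skew trt_skew jacobi)
    fix x y z w t
    show "trt (br x y) z w + trt (br y z) x w + trt (br z x) y w = 0"
    proof (rule om_nondeg_right)
      fix u
      show "om u (trt (br x y) z w + trt (br y z) x w + trt (br z x) y w) = 0"
        using preLY2_pairing[where x = u and y = w and z = y and w = z and t = x]
        by (simp add: P2 om_zero)
    qed
    show "trt x y (br z w) = br (trt x y z) w + br z (trt x y w)"
    proof (rule om_diff_eqI_right)
      fix u
      show "om u (trt x y (br z w) - (br (trt x y z) w + br z (trt x y w))) = 0"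
        using preLY1_pairing[where z = u and x = z and y = w and w = y and t = x]
        by (simp add: P1 om_zero)
    qed
    show "trt x y (trt z w t) = trt (trt x y z) w t + trt z (trt x y w) t + trt z w (trt x y t)"
    proof (rule om_diff_eqI_right)
      fix u
      show "om u (trt x y (trt z w t)
          - (trt (trt x y z) w t + trt z (trt x y w) t + trt z w (trt x y t))) = 0"
        using preLY4_pairing[where z = u and w = t and t = w and s = z]
        by (simp add: P4 om_zero)
    qed
  qed
qed

lemma preLY_of_LY:
  assumes "LY sc br trt"
  shows "preLY sc mul tri"
proof -
  from assms have LY2: "\<And>x y z w. trt (br x y) z w + trt (br y z) x w + trt (br z x) y w = 0"
    unfolding LY_def by iprover
  from assms have LY3: "\<And>x y z w. trt x y (br z w) - (br (trt x y z) w + br z (trt x y w)) = 0"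
    unfolding LY_def right_minus_eq by iprover
  from assms have LY4: "\<And>x y z w t. trt x y (trt z w t)
        - (trt (trt x y z) w t + trt z (trt x y w) t + trt z w (trt x y t)) = 0"
    unfolding LY_def right_minus_eq by iprover
  show ?thesis
    unfolding preLY_def
  proof (intro conjI allI mul_bilinear tri_trilinear)
    fix x y z w t
    show "tri z (commC mul x y) w - tri (mul y z) x w + tri (mul x z) y w = 0"
      by (rule om_nondeg) (simp only: preLY1_pairing LY3 om_zero)
    show "tri x y (commC mul z w) = mul z (tri x y w) - mul w (tri x y z)"
      by (rule om_diff_eqI) (simp only: preLY2_pairing LY2 om_zero minus_zero)
    show "tri (tri x y z) w t - tri (tri x y w) z t - tri x y (triD mul tri z w t)
        - tri x y (tri z w t) + tri x y (tri w z t) + triD mul tri z w (tri x y t) = 0"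
      by (rule om_nondeg) (simp only: preLY3_pairing LY4 add_0 om_zero)
    show "tri z (triD mul tri x y w) t + tri z (tri x y w) t - tri z (tri y x w) t
        + tri z w (triD mul tri x y t) + tri z w (tri x y t) - tri z w (tri y x t)
        = triD mul tri x y (tri z w t) - tri (triD mul tri x y z) w t"
      by (rule om_diff_eqI) (simp only: preLY4_pairing LY4 om_zero minus_zero)
    show "mul (triD mul tri x y z) w + mul (tri x y z) w - mul (tri y x z) w
        = triD mul tri x y (mul z w) - mul z (triD mul tri x y w)"
      by (rule om_diff_eqI) (simp only: preLY5_pairing LY3 om_zero)
  qed
qed

lemma preLY_iff_LY: "preLY sc mul tri \<longleftrightarrow> LY sc br trt"
  using LY_of_preLY preLY_of_LY by blast

end

section \<open>Quadratic pre-Lie-Yamaguti algebras and symplectic Lie-Yamaguti algebras\<close>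

lemma subadjacent_brackets_of_quadratic_preLY:
  assumes "quadratic_preLY sc mul tri om"
  shows "subadjacent_brackets sc om mul tri (commC mul) (triC mul tri)"
proof -
  from assms[unfolded quadratic_preLY_def preLY_def]
  have "nondeg_skew_form sc om" and mul: "bilinear_op sc mul" and "trilinear_op sc tri"
    and "\<And>x y z. om (mul x y) z = - om y (commC mul x z)"
    and "\<And>x y z w. om (tri x y z) w = om x (triC mul tri w z y)"
    by iprover+
  with subadjacent_jacobi[OF mul] triC_skew show ?thesis
    by unfold_locales iprover+
qed

theorem symplectic_LY_of_quadratic_preLY:
  fixes om :: "'v::ab_group_add \<Rightarrow> 'v \<Rightarrow> 'k::field"
  assumes quadratic: "quadratic_preLY sc mul tri om" and three: "(3::'k) \<noteq> 0"
  shows "LY sc (commC mul) (triC mul tri) \<and> symplectic sc om (commC mul) (triC mul tri)"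
proof -
  interpret subadjacent_brackets sc om mul tri "commC mul" "triC mul tri"
    using quadratic by (rule subadjacent_brackets_of_quadratic_preLY)
  have "preLY sc mul tri"
    using quadratic unfolding quadratic_preLY_def by iprover
  moreover have "\<forall>x y z. om x (commC mul y z) + om y (commC mul z x) + om z (commC mul x y) = 0"
    using cyclic_of_commC_eq[OF mul_adjoint refl three] by iprover
  ultimately show ?thesis
    unfolding symplectic_def using preLY_iff_LY nondeg_skew triC_eq_iff_symplectic by blast
qed

theorem quadratic_preLY_of_symplectic_LY:
  assumes LY: "LY sc br tr" and symplectic: "symplectic sc om br tr"
    and mul_adjoint: "\<And>x y z. om (mul x y) z = - om y (br x z)"
    and tri_adjoint: "\<And>x y z w. om (tri x y z) w = om x (tr w z y)"
  shows "quadratic_preLY sc mul tri om \<and> commC mul = br \<and> triC mul tri = tr"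
proof -
  from symplectic[unfolded symplectic_def]
  have form: "nondeg_skew_form sc om"
    and cyclic: "\<And>x y z. om x (br y z) + om y (br z x) + om z (br x y) = 0"
    and ST: "\<forall>x y z w. om z (tr x y w) - om x (tr w z y) + om y (tr w z x) - om w (tr x y z) = 0"
    by iprover+
  from LY[unfolded LY_def]
  have br: "bilinear_op sc br" and tr: "trilinear_op sc tr"
    and br_skew: "\<And>x y. br x y = - br y x" and tr_skew: "\<And>x y z. tr x y z = - tr y x z"
    and jacobi: "\<And>x y z. br (br x y) z + br (br y z) x + br (br z x) y + tr x y z + tr y z x + tr z x y = 0"
    by iprover+
  interpret skew_form sc om
    by unfold_locales (rule form)
  have commC: "commC mul = br"
    using mul_adjoint br_skew cyclic by (rule commC_eq_of_cyclic)
  have "bilinear_op sc mul"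
    using br bilinear_op_iff_adjoint[of mul br, OF mul_adjoint] by blast
  moreover have "trilinear_op sc tri"
    using tr trilinear_op_iff_adjoint[of tri tr, OF tri_adjoint] by blast
  ultimately interpret adjoint_brackets sc om mul tri br tr
    using commC tr_skew mul_adjoint tri_adjoint jacobi by unfold_locales iprover+
  have triC: "triC mul tri = tr"
    using ST triC_eq_iff_symplectic by blast
  then interpret subadjacent_brackets sc om mul tri br tr
    by unfold_locales
  have "preLY sc mul tri"
    using LY preLY_iff_LY by blast
  with form show ?thesis
    unfolding quadratic_preLY_def by (simp add: commC triC mul_adjoint tri_adjoint)
qed

section \<open>The symplectic form on \<open>A \<oplus> A*\<close>\<close>

lemma dpair_zero [simp]: "dpair 0 x = 0" "dpair a 0 = 0"
  by (simp_all add: dpair_def)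

lemma dpair_axis_left: "dpair (axis i 1) x = x $ i"
proof -
  have "dpair (axis i 1) x = (\<Sum>j\<in>UNIV. if j = i then x $ j else 0)"
    unfolding dpair_def by (rule sum.cong) (auto simp: axis_def)
  then show ?thesis
    by simp
qed

lemma dpair_axis_right: "dpair a (axis i 1) = a $ i"
proof -
  have "dpair a (axis i 1) = (\<Sum>j\<in>UNIV. if j = i then a $ j else 0)"
    unfolding dpair_def by (rule sum.cong) (auto simp: axis_def)
  then show ?thesis
    by simp
qed

lemma omega_p_nondeg_skew: "nondeg_skew_form dsc (omega_p :: ('k::field, 'n::finite) dbl \<Rightarrow> _)"
  unfolding nondeg_skew_form_def
proof (intro conjI allI impI)
  show "bilinear_form dsc (omega_p :: ('k, 'n) dbl \<Rightarrow> _)"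
    unfolding bilinear_form_def omega_p_def dsc_def dpair_def
    by (simp add: algebra_simps sum.distrib sum_distrib_left sum_subtractf)
  fix X Y :: "('k, 'n) dbl"
  show "omega_p X Y = - omega_p Y X"
    by (simp add: omega_p_def)
next
  fix X :: "('k, 'n) dbl"
  assume X: "\<forall>Y. omega_p X Y = 0"
  have "snd X $ i = 0" for i
    using X[rule_format, of "(axis i 1, 0)"] by (simp add: omega_p_def dpair_axis_right)
  moreover have "fst X $ i = 0" for i
    using X[rule_format, of "(0, axis i 1)"] by (simp add: omega_p_def dpair_axis_left)
  ultimately show "X = 0"
    by (simp add: prod_eq_iff vec_eq_iff)
qed

interpretation omega_p: skew_form dsc "omega_p :: ('k::field, 'n::finite) dbl \<Rightarrow> _"
  by unfold_locales (rule omega_p_nondeg_skew)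

lemma vec_functional_expansion:
  fixes g :: "'k::field ^ 'n::finite \<Rightarrow> 'k"
  assumes add: "\<And>x y. g (x + y) = g x + g y" and scale: "\<And>c x. g (c *s x) = c * g x"
  shows "g x = (\<Sum>i\<in>UNIV. x $ i * g (axis i 1))"
proof -
  interpret Modules.additive g
    by unfold_locales (rule add)
  have "g x = g (\<Sum>i\<in>UNIV. x $ i *s axis i 1)"
    by (simp add: basis_expansion)
  also have "\<dots> = (\<Sum>i\<in>UNIV. x $ i * g (axis i 1))"
    by (simp add: sum scale)
  finally show ?thesis .
qed

lemma omega_p_represents:
  fixes f :: "('k::field, 'n::finite) dbl \<Rightarrow> 'k"
  assumes add: "\<And>X Y. f (X + Y) = f X + f Y" and scale: "\<And>c X. f (dsc c X) = c * f X"
  shows "\<exists>P. \<forall>Z. omega_p P Z = f Z"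
proof (intro exI allI)
  fix Z :: "('k, 'n) dbl"
  obtain y b where Z: "Z = (y, b)"
    by (cases Z)
  have f_fst: "f (y, 0) = (\<Sum>i\<in>UNIV. y $ i * f (axis i 1, 0))"
    by (rule vec_functional_expansion[where g = "\<lambda>y. f (y, 0)"])
      (use add[of "(_, 0)" "(_, 0)"] scale[of _ "(_, 0)"] in \<open>simp_all add: dsc_def\<close>)
  have f_snd: "f (0, b) = (\<Sum>i\<in>UNIV. b $ i * f (0, axis i 1))"
    by (rule vec_functional_expansion[where g = "\<lambda>b. f (0, b)"])
      (use add[of "(0, _)" "(0, _)"] scale[of _ "(0, _)"] in \<open>simp_all add: dsc_def\<close>)
  show "omega_p ((\<chi> i. - f (0, axis i 1)), (\<chi> i. f (axis i 1, 0))) Z = f Z"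
    using add[of "(y, 0)" "(0, b)"]
    by (simp add: Z omega_p_def dpair_def f_fst f_snd sum_negf mult.commute)
qed

lemma ind_mul_eq_iff:
  assumes "bilinear_op dsc br"
  shows "ind_mul br = mul \<longleftrightarrow> (\<forall>X Y Z. omega_p (mul X Y) Z = - omega_p Y (br X Z))"
proof -
  have "(THE P. \<forall>Z. omega_p P Z = - omega_p Y (br X Z)) = mul X Y
      \<longleftrightarrow> (\<forall>Z. omega_p (mul X Y) Z = - omega_p Y (br X Z))" for X Y
    by (rule omega_p.the_om_eq, rule omega_p_represents)
      (simp_all add: bilinear_op_laws[OF assms] omega_p.om_laws)
  then show ?thesis
    unfolding ind_mul_def fun_eq_iff by blast
qed

lemma ind_tri_eq_iff:
  assumes "trilinear_op dsc tr"
  shows "ind_tri tr = tri \<longleftrightarrow> (\<forall>X Y Z W. omega_p (tri X Y Z) W = omega_p X (tr W Z Y))"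
proof -
  have "(THE P. \<forall>W. omega_p P W = omega_p X (tr W Z Y)) = tri X Y Z
      \<longleftrightarrow> (\<forall>W. omega_p (tri X Y Z) W = omega_p X (tr W Z Y))" for X Y Z
    by (rule omega_p.the_om_eq, rule omega_p_represents)
      (simp_all add: trilinear_op_laws[OF assms] omega_p.om_laws)
  then show ?thesis
    unfolding ind_tri_def fun_eq_iff by blast
qed

lemma inA_fst: "isA X \<Longrightarrow> inA (fst X) = X"
  by (simp add: isA_def inA_def prod_eq_iff)

lemma inD_snd: "isD X \<Longrightarrow> inD (snd X) = X"
  by (simp add: isD_def inD_def prod_eq_iff)

lemma isA_inA [simp]: "isA (inA x)" and isD_inD [simp]: "isD (inD a)"
  by (simp_all add: isA_def inA_def isD_def inD_def)

lemma additive_inA: "Modules.additive inA" and additive_inD: "Modules.additive inD"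
  by unfold_locales (simp_all add: inA_def inD_def)

lemma inA_scale: "inA (c *s x) = dsc c (inA x)"
  by (simp add: inA_def dsc_def)

lemma inj_inA: "inj inA"
  by (simp add: inj_def inA_def)

lemma omega_p_isA: "isA X \<Longrightarrow> isA Y \<Longrightarrow> omega_p X Y = 0"
  by (simp add: isA_def omega_p_def)

lemma omega_p_isD: "isD X \<Longrightarrow> isD Y \<Longrightarrow> omega_p X Y = 0"
  by (simp add: isD_def omega_p_def)

lemma isA_if_orthogonal: "(\<And>y. omega_p X (inA y) = 0) \<Longrightarrow> isA X"
proof -
  assume orth: "\<And>y. omega_p X (inA y) = 0"
  have "snd X $ i = 0" for i
    using orth[of "axis i 1"] by (simp add: omega_p_def inA_def dpair_axis_right)
  then show ?thesis
    by (simp add: isA_def vec_eq_iff)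
qed

lemma isD_if_orthogonal: "(\<And>b. omega_p X (inD b) = 0) \<Longrightarrow> isD X"
proof -
  assume orth: "\<And>b. omega_p X (inD b) = 0"
  have "fst X $ i = 0" for i
    using orth[of "axis i 1"] by (simp add: omega_p_def inD_def dpair_axis_left)
  then show ?thesis
    by (simp add: isD_def vec_eq_iff)
qed

section \<open>Manin triples and perfect phase spaces\<close>

lemma manin_triple_symplectic_phase_space:
  fixes mul :: "('k::field_char_0, 'n::finite) dbl \<Rightarrow> ('k, 'n) dbl \<Rightarrow> ('k, 'n) dbl"
  assumes "manin_triple mul tri"
  shows "LY dsc (commC mul) (triC mul tri) \<and> symplectic dsc omega_p (commC mul) (triC mul tri) \<and>
    phase_space (commC (restrA2 mul)) (triC (restrA2 mul) (restrA3 tri)) (commC mul) (triC mul tri)"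
proof -
  from assms[unfolded manin_triple_def]
  have quadratic: "quadratic_preLY dsc mul tri omega_p"
    and A_mul: "\<And>x y. isA (mul (inA x) (inA y))"
    and A_tri: "\<And>x y z. isA (tri (inA x) (inA y) (inA z))"
    and D_mul: "\<And>a b. isD (mul (inD a) (inD b))"
    and D_tri: "\<And>a b c. isD (tri (inD a) (inD b) (inD c))"
    by blast+
  have "(3::'k) \<noteq> 0"
    by simp
  with quadratic have LY: "LY dsc (commC mul) (triC mul tri)"
    and symplectic: "symplectic dsc omega_p (commC mul) (triC mul tri)"
    by (blast dest: symplectic_LY_of_quadratic_preLY)+
  have inA_mul: "inA (restrA2 mul x y) = mul (inA x) (inA y)" for x y
    unfolding restrA2_def using A_mul by (rule inA_fst)
  have inA_tri: "inA (restrA3 tri x y z) = tri (inA x) (inA y) (inA z)" for x y z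
    unfolding restrA3_def using A_tri by (rule inA_fst)
  note commC_A = commC_hom[of inA "restrA2 mul" mul, OF additive_inA inA_mul]
    and triC_A = triC_hom[of inA "restrA2 mul" mul "restrA3 tri" tri, OF additive_inA inA_mul inA_tri]
  have inD_mul: "inD (snd (mul (inD a) (inD b))) = mul (inD a) (inD b)" for a b
    using D_mul by (rule inD_snd)
  have inD_tri: "inD (snd (tri (inD a) (inD b) (inD c))) = tri (inD a) (inD b) (inD c)" for a b c
    using D_tri by (rule inD_snd)
  have "isD (commC mul (inD a) (inD b))" for a b
    using commC_hom[of inD _ mul, OF additive_inD inD_mul] isD_inD by metis
  moreover have "isD (triC mul tri (inD a) (inD b) (inD c))" for a b c
    using triC_hom[of inD _ mul _ tri, OF additive_inD inD_mul inD_tri] isD_inD by metis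
  moreover have "LY (*s) (commC (restrA2 mul)) (triC (restrA2 mul) (restrA3 tri))"
    by (rule LY_pullback[where f = inA and M = "commC mul" and T = "triC mul tri"])
      (fact LY inj_inA additive_inA inA_scale commC_A triC_A)+
  ultimately show ?thesis
    unfolding phase_space_def using LY symplectic by (simp add: commC_A triC_A)
qed

lemma manin_triple_perfect:
  assumes "manin_triple mul tri"
  shows "perfect (triC mul tri)"
proof -
  from assms[unfolded manin_triple_def]
  have quadratic: "quadratic_preLY dsc mul tri omega_p"
    and mixed_A: "\<And>x a b. isA (tri (inD a) (inD b) (inA x))" "\<And>x a b. isA (tri (inA x) (inD a) (inD b))"
    and mixed_D: "\<And>x y a. isD (tri (inA x) (inA y) (inD a))" "\<And>x y a. isD (tri (inD a) (inA x) (inA y))"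
    by blast+
  interpret subadjacent_brackets dsc omega_p mul tri "commC mul" "triC mul tri"
    using quadratic by (rule subadjacent_brackets_of_quadratic_preLY)
  have adjoint: "omega_p (triC mul tri W Z Y) X = - omega_p (tri X Y Z) W" for X Y Z W
    using tri_adjoint[of X Y Z W] omega_p.om_skew[of X] by simp
  show ?thesis
    unfolding perfect_def
    by (intro allI conjI isA_if_orthogonal isD_if_orthogonal)
      (simp_all add: adjoint omega_p_isA omega_p_isD mixed_A mixed_D)
qed

lemma manin_triple_ind:
  assumes "manin_triple mul tri"
  shows "ind_mul (commC mul) = mul \<and> ind_tri (triC mul tri) = tri"
proof -
  from assms have "quadratic_preLY dsc mul tri omega_p"
    unfolding manin_triple_def by blast
  then interpret subadjacent_brackets dsc omega_p mul tri "commC mul" "triC mul tri"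
    by (rule subadjacent_brackets_of_quadratic_preLY)
  show ?thesis
    using ind_mul_eq_iff[OF br_bilinear] ind_tri_eq_iff[OF trt_trilinear] mul_adjoint tri_adjoint
    by blast
qed

lemma phase_space_ind_adjoint:
  assumes "phase_space brh trh br tr"
  shows "omega_p (ind_mul br X Y) Z = - omega_p Y (br X Z)"
    and "omega_p (ind_tri tr X Y Z) W = omega_p X (tr W Z Y)"
proof -
  from assms have "bilinear_op dsc br" and "trilinear_op dsc tr"
    unfolding phase_space_def LY_def by iprover+
  then show "omega_p (ind_mul br X Y) Z = - omega_p Y (br X Z)"
    and "omega_p (ind_tri tr X Y Z) W = omega_p X (tr W Z Y)"
    using ind_mul_eq_iff[of br "ind_mul br"] ind_tri_eq_iff[of tr "ind_tri tr"] by blast+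
qed

lemma phase_space_ind_quadratic_preLY:
  assumes "phase_space brh trh br tr"
  shows "quadratic_preLY dsc (ind_mul br) (ind_tri tr) omega_p
    \<and> commC (ind_mul br) = br \<and> triC (ind_mul br) (ind_tri tr) = tr"
proof -
  from assms have LY: "LY dsc br tr" and symplectic: "symplectic dsc omega_p br tr"
    unfolding phase_space_def by iprover+
  from LY symplectic phase_space_ind_adjoint[OF assms] show ?thesis
    by (rule quadratic_preLY_of_symplectic_LY)
qed

lemma perfect_phase_space_manin_triple:
  assumes phase_space: "phase_space brh trh br tr" and perfect: "perfect tr"
  shows "manin_triple (ind_mul br) (ind_tri tr)"
proof -
  from phase_space[unfolded phase_space_def LY_def]
  have br_A: "\<And>x y. br (inA x) (inA y) = inA (brh x y)"
    and tr_A: "\<And>x y z. tr (inA x) (inA y) (inA z) = inA (trh x y z)"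
    and br_D: "\<And>a b. isD (br (inD a) (inD b))" and tr_D: "\<And>a b c. isD (tr (inD a) (inD b) (inD c))"
    and tr_skew: "\<And>X Y Z. tr X Y Z = - tr Y X Z"
    by iprover+
  from perfect[unfolded perfect_def]
  have mixed: "\<And>x a b. isA (tr (inD a) (inD b) (inA x))" "\<And>x a b. isA (tr (inA x) (inD a) (inD b))"
      "\<And>x y a. isD (tr (inA x) (inA y) (inD a))" "\<And>x y a. isD (tr (inD a) (inA x) (inA y))"
    by iprover+
  have mixed_swapped: "isA (tr (inD a) (inA x) (inD b))" "isD (tr (inA x) (inD a) (inA y))" for x y a b
    using tr_skew[of "inD a" "inA x" "inD b"] mixed(2)[of x a b]
      tr_skew[of "inA x" "inD a" "inA y"] mixed(4)[of a x y]
    by (simp_all add: isA_def isD_def)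
  have quadratic: "quadratic_preLY dsc (ind_mul br) (ind_tri tr) omega_p"
    using phase_space_ind_quadratic_preLY[OF phase_space] by blast
  note adjoint = phase_space_ind_adjoint[OF phase_space]
  show ?thesis
    unfolding manin_triple_def
    by (intro conjI allI quadratic isA_if_orthogonal isD_if_orthogonal)
      (simp_all add: adjoint br_A tr_A omega_p_isA omega_p_isD br_D tr_D mixed mixed_swapped)
qed

theorem theorem4p13:
  fixes mul :: "('k::field_char_0, 'n::finite) dbl \<Rightarrow> ('k, 'n) dbl \<Rightarrow> ('k, 'n) dbl"
    and tri :: "('k, 'n) dbl \<Rightarrow> ('k, 'n) dbl \<Rightarrow> ('k, 'n) dbl \<Rightarrow> ('k, 'n) dbl"
    and brh :: "'k ^ 'n \<Rightarrow> 'k ^ 'n \<Rightarrow> 'k ^ 'n"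
    and trh :: "'k ^ 'n \<Rightarrow> 'k ^ 'n \<Rightarrow> 'k ^ 'n \<Rightarrow> 'k ^ 'n"
    and br :: "('k, 'n) dbl \<Rightarrow> ('k, 'n) dbl \<Rightarrow> ('k, 'n) dbl"
    and tr :: "('k, 'n) dbl \<Rightarrow> ('k, 'n) dbl \<Rightarrow> ('k, 'n) dbl \<Rightarrow> ('k, 'n) dbl"
  shows
    \<comment> \<open>(a)\<close>
    "(manin_triple mul tri \<longrightarrow>
        LY dsc (commC mul) (triC mul tri) \<and> symplectic dsc omega_p (commC mul) (triC mul tri) \<and>
        phase_space (commC (restrA2 mul)) (triC (restrA2 mul) (restrA3 tri))
                    (commC mul) (triC mul tri))
   \<and> \<comment> \<open>(b)\<close>
     (phase_space brh trh br tr \<and> perfect tr \<longrightarrow>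
        manin_triple (ind_mul br) (ind_tri tr))
   \<and> \<comment> \<open>one-to-one correspondence: the two constructions are mutually inverse\<close>
     (manin_triple mul tri \<longrightarrow>
        perfect (triC mul tri) \<and>
        ind_mul (commC mul) = mul \<and> ind_tri (triC mul tri) = tri)
   \<and> (phase_space brh trh br tr \<and> perfect tr \<longrightarrow>
        commC (ind_mul br) = br \<and> triC (ind_mul br) (ind_tri tr) = tr)"
  using manin_triple_symplectic_phase_space[of mul tri] manin_triple_perfect[of mul tri]
    manin_triple_ind[of mul tri] perfect_phase_space_manin_triple[of brh trh br tr]
    phase_space_ind_quadratic_preLY[of brh trh br tr]
  by blast

end
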